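(* Let $d$ and $q$ be positive integers and let $X$ be a set of $(d+1)(q-1)+1$ points in $(\mathbb{R}\cup\{-\infty\})^d$. Then there are $q$ pairwise disjoint subsets $X_1, X_2,\ldots,X_q$ of $X$ whose max-plus convex hulls have a common point.
   Context: Write $\mathbb{R}_{\max}=\mathbb{R}\cup\{-\infty\}$, with $-\infty+a=-\infty$ for all $a\in\mathbb{R}_{\max}$ and $-\infty\le a$ for all $a$. For $\lambda\in\mathbb{R}_{\max}$ and $\boldsymbol{x}=(x_1,\ldots,x_d)\in\mathbb{R}_{\max}^d$, $\lambda+\boldsymbol{x}$ denotes $(\lambda+x_1,\ldots,\lambda+x_d)$; the maximum of finitely many vectors is taken componentwise. The max-plus convex hull of points $\boldsymbol{x}_1,\ldots,\boldsymbol{x}_n\in\mathbb{R}_{\max}^d$ is the set of points $\boldsymbol{x}\in\mathbb{R}_{\max}^d$ for which there exist $\lambda_1,\ldots,\lambda_n\in\mathbb{R}_{\max}$ with $\max_{i}\lambda_i=0$ and $\boldsymbol{x}=\max_{i=1,\ldots,n}(\lambda_i+\boldsymbol{x}_i)$ (in particular the hull of the empty set is empty). *)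

theory Defs
  imports "HOL-Analysis.Analysis"
begin

text \<open>
  The max-plus numbers are the extended reals other than \<open>\<infinity>\<close>. On them, addition and
  order of \<^typ>\<open>ereal\<close> are the max-plus ones; in particular \<open>-\<infinity> + a = -\<infinity>\<close> for \<open>a \<noteq> \<infinity>\<close>.
\<close>

definition Rmax :: "ereal set" where
  "Rmax = {a. a \<noteq> \<infinity>}"

definition Rmax_vecs :: "(ereal ^ 'd) set" where
  "Rmax_vecs = {x. \<forall>i. x $ i \<in> Rmax}"

definition shift :: "ereal \<Rightarrow> ereal ^ 'd \<Rightarrow> ereal ^ 'd" where
  "shift c x = (\<chi> i. c + x $ i)"

definition max_vec :: "(ereal ^ 'd) set \<Rightarrow> ereal ^ 'd" where
  "max_vec A = (\<chi> i. Max ((\<lambda>x. x $ i) ` A))"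

text \<open>
  Meaningful only for finite \<open>S\<close>, as \<^const>\<open>Max\<close> is unspecified on infinite sets. It is also
  unspecified on the empty set, hence the condition \<open>S \<noteq> {}\<close>, which makes the hull of the
  empty set empty.
\<close>

definition maxplus_hull :: "(ereal ^ 'd) set \<Rightarrow> (ereal ^ 'd) set" where
  "maxplus_hull S = {x \<in> Rmax_vecs. S \<noteq> {} \<and>
     (\<exists>c. (\<forall>p\<in>S. c p \<in> Rmax) \<and> Max (c ` S) = 0 \<and> x = max_vec ((\<lambda>p. shift (c p) p) ` S))}"

end

theory Submission
  imports Defs "HOL-Combinatorics.Cycles" "HOL-Computational_Algebra.Polynomial"
begin

text \<open>
  Add a coordinate \<open>0\<close> to every point, so that \<open>m = d + 1\<close> and there are \<open>m(q - 1) + 1\<close> rows. It then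
  suffices to find row weights \<open>u\<close> and a colouring of the rows by \<open>q\<close> colours such that in every column
  \<open>k\<close> the maximum \<open>M k\<close> of \<open>u i + a i k\<close> is attained in every colour.

  Set one row \<open>r\<close> aside and assign the others to the columns, \<open>q - 1\<close> to each, with maximal total weight.
  Moving a row \<open>j\<close> from column \<open>k\<close> to column \<open>l\<close> gains \<open>a j l - a j k\<close>; by optimality no cycle of moves has a
  positive gain, so longest walks from \<open>r\<close> define a potential \<open>M\<close>. The rows assigned to \<open>k\<close> and the
  last row on a longest walk to \<open>k\<close> all attain \<open>M k\<close>. These \<open>q\<close> rows per column form a tree, which
  is coloured greedily from \<open>r\<close>.

  The entries \<open>-\<infinity>\<close> would break the potential argument, so the combinatorial part works over an ordered
  abelian group. It is applied to real polynomials, ordered by their behaviour at infinity,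
  with \<open>-\<infinity>\<close> replaced by the polynomial \<open>-X\<close>.
\<close>

section \<open>Walks in a complete weighted digraph\<close>

fun walk_weight :: "('c \<Rightarrow> 'c \<Rightarrow> 'g::linordered_ab_group_add) \<Rightarrow> 'c list \<Rightarrow> 'g" where
  "walk_weight w (x # y # r) = w x y + walk_weight w (y # r)"
| "walk_weight w _ = 0"

lemma walk_weight_append:
  "walk_weight w (as @ x # bs) = walk_weight w (as @ [x]) + walk_weight w (x # bs)"
  by (induction w as rule: walk_weight.induct) (auto simp: add.assoc neq_Nil_conv)

lemma walk_weight_snoc:
  "as \<noteq> [] \<Longrightarrow> walk_weight w (as @ [x]) = walk_weight w as + w (last as) x"
  by (induction w as rule: walk_weight.induct) (auto simp: add.assoc)

lemma walk_weight_eq_sum_list: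
  "walk_weight w (x # bs @ [y]) = sum_list (map2 w (x # bs) (bs @ [y]))"
  by (induction bs arbitrary: x) auto

lemma map_pair_eq_map2: "map (\<lambda>x. f x (g x)) xs = map2 f xs (map g xs)"
  by (induction xs) auto

text \<open>A repeated vertex splits the closed walk into two shorter closed walks. Without
  repetition the walk follows a cyclic permutation of its vertices, and all other vertices are fixed
  points, which contribute \<open>w k k = 0\<close>.\<close>

lemma closed_walk_weight_nonpos:
  fixes w :: "'c::finite \<Rightarrow> 'c \<Rightarrow> 'g::linordered_ab_group_add"
  assumes perm: "\<And>\<pi>. \<pi> permutes UNIV \<Longrightarrow> (\<Sum>k\<in>UNIV. w k (\<pi> k)) \<le> 0"
    and refl: "\<And>k. w k k = 0"
  shows "walk_weight w (x # bs @ [x]) \<le> 0"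
proof (induction "length bs" arbitrary: x bs rule: less_induct)
  case less
  show ?case
  proof (cases "distinct (x # bs)")
    case True
    let ?xs = "x # bs" and ?\<pi> = "cycle_of_list (x # bs)"
    have "?\<pi> permutes set ?xs" by (rule cycle_permutes)
    then have "?\<pi> permutes UNIV" by (rule permutes_subset) simp
    then have "(\<Sum>k\<in>UNIV. w k (?\<pi> k)) \<le> 0" by (rule perm)
    also have "(\<Sum>k\<in>UNIV. w k (?\<pi> k)) = (\<Sum>k\<in>set ?xs. w k (?\<pi> k))"
      by (rule sum.mono_neutral_right) (auto simp: refl id_outside_supp simp del: cycle_of_list.simps)
    also have "\<dots> = sum_list (map (\<lambda>k. w k (?\<pi> k)) ?xs)"
      by (rule sum_list_distinct_conv_sum_set[symmetric, OF True])
    also have "map (\<lambda>k. w k (?\<pi> k)) ?xs = map2 w ?xs (map ?\<pi> ?xs)"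
      by (rule map_pair_eq_map2)
    also have "map ?\<pi> ?xs = bs @ [x]"
      using cyclic_rotation[of ?xs 1] True by simp
    finally show ?thesis by (simp only: walk_weight_eq_sum_list)
  next
    case False
    then obtain as y cs ds where dec: "x # bs = as @ [y] @ cs @ [y] @ ds"
      using not_distinct_decomp by blast
    have inner: "walk_weight w (y # cs @ [y]) \<le> 0"
    proof (rule less.hyps)
      show "length cs < length bs" using arg_cong[OF dec, of length] by simp
    qed
    have outer: "walk_weight w (as @ [y] @ ds @ [x]) \<le> 0"
    proof (cases as)
      case Nil
      then have "length ds < length bs" "y = x" using dec by auto
      then show ?thesis using less.hyps Nil by simp
    next
      case (Cons z as')
      then have "length (as' @ [y] @ ds) < length bs" "z = x" using dec by auto
      then show ?thesis using less.hyps[of "as' @ [y] @ ds"] Cons by simp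
    qed
    have "x # bs @ [x] = as @ y # cs @ y # ds @ [x]"
      using arg_cong[OF dec, of "\<lambda>p. p @ [x]"] by simp
    then have "walk_weight w (x # bs @ [x]) =
        walk_weight w (as @ [y]) + (walk_weight w (y # cs @ [y]) + walk_weight w (y # ds @ [x]))"
      using walk_weight_append[of w as y "cs @ y # ds @ [x]"]
        walk_weight_append[of w "y # cs" y "ds @ [x]"] by (simp only: append_Cons)
    also have "\<dots> = walk_weight w (y # cs @ [y]) + walk_weight w (as @ [y] @ ds @ [x])"
      using walk_weight_append[of w as y "ds @ [x]"] by (simp add: algebra_simps)
    also have "\<dots> \<le> 0" using inner outer by (rule add_nonpos_nonpos)
    finally show ?thesis .
  qed
qed

text \<open>\<open>M k\<close> is the largest value, over walks ending in \<open>k\<close>, of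
  \<open>b\<close> at the start plus the weight of the walk. Deleting closed subwalks never lowers
  this value, so the finitely many simple walks suffice. The rank makes the passage from a column to
  its predecessor well-founded.\<close>

lemma longest_walk_potential:
  fixes w :: "'c::finite \<Rightarrow> 'c \<Rightarrow> 'g::linordered_ab_group_add" and b :: "'c \<Rightarrow> 'g"
  assumes perm: "\<And>\<pi>. \<pi> permutes UNIV \<Longrightarrow> (\<Sum>k\<in>UNIV. w k (\<pi> k)) \<le> 0"
    and refl: "\<And>k. w k k = 0"
  shows "\<exists>M. \<exists>rank :: 'c \<Rightarrow> nat. (\<forall>k. b k \<le> M k) \<and> (\<forall>k l. M k + w k l \<le> M l) \<and>
    (\<forall>k. M k = b k \<or> (\<exists>l. rank l < rank k \<and> M k = M l + w l k))"
proof -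
  define v where "v p = b (hd p) + walk_weight w p" for p
  define P where "P k = {p. p \<noteq> [] \<and> last p = k}" for k :: 'c
  define D where "D k = {p \<in> P k. distinct p}" for k
  define M where "M k = Max (v ` D k)" for k
  \<comment> \<open>The number of vertices on a shortest walk of maximal value.\<close>
  define rank where "rank k = (LEAST n. \<exists>p\<in>P k. v p = M k \<and> length p = n)" for k
  have fin: "finite (D k)" for k
  proof (rule finite_subset)
    show "D k \<subseteq> {p. set p \<subseteq> UNIV \<and> length p \<le> CARD('c)}"
    proof
      fix p assume "p \<in> D k"
      then have "length p = card (set p)" by (simp add: D_def distinct_card)
      also have "\<dots> \<le> CARD('c)" by (simp add: card_mono)
      finally show "p \<in> {p. set p \<subseteq> UNIV \<and> length p \<le> CARD('c)}" by simp
    qed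
  qed (rule finite_lists_length_le, simp)
  have D: "[k] \<in> D k" for k by (simp add: D_def P_def)
  have att: "\<exists>p\<in>P k. v p = M k" for k
  proof -
    have "M k \<in> v ` D k" unfolding M_def using fin D by (intro Max_in) auto
    then show ?thesis by (auto simp: D_def)
  qed
  have vM: "v p \<le> M k" if "p \<in> P k" for p k
    using that
  proof (induction "length p" arbitrary: p rule: less_induct)
    case less
    show ?case
    proof (cases "distinct p")
      case True
      then show ?thesis using less.prems fin by (simp add: M_def D_def)
    next
      case False
      then obtain as y cs ds where dec: "p = as @ [y] @ cs @ [y] @ ds"
        using not_distinct_decomp by blast
      let ?p = "as @ y # ds"
      have "v ?p \<le> M k"
        using less.prems by (intro less.hyps) (auto simp: dec P_def split: if_splits)
      moreover have "v p = v ?p + walk_weight w (y # cs @ [y])"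
      proof -
        have "walk_weight w p = walk_weight w (as @ [y]) + (walk_weight w (y # cs @ [y]) + walk_weight w (y # ds))"
          using walk_weight_append[of w as y "cs @ y # ds"]
            walk_weight_append[of w "y # cs" y ds] by (simp add: dec)
        moreover have "hd p = hd ?p" by (simp add: dec hd_append)
        ultimately show ?thesis
          using walk_weight_append[of w as y ds] by (simp add: v_def algebra_simps)
      qed
      moreover have "walk_weight w (y # cs @ [y]) \<le> 0"
        using perm refl by (rule closed_walk_weight_nonpos)
      ultimately show ?thesis
        using add_mono[of "v ?p" "M k" "walk_weight w (y # cs @ [y])" 0] by simp
    qed
  qed
  have v_snoc: "v (p @ [l]) = v p + w k l" if "p \<in> P k" for p k l
    using that by (simp add: v_def P_def walk_weight_snoc add.assoc)
  show ?thesis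
  proof (intro exI[of _ M] exI[of _ rank] conjI allI)
    show "b k \<le> M k" for k using vM[of "[k]" k] by (simp add: P_def v_def)
    show step: "M k + w k l \<le> M l" for k l
    proof -
      obtain p where p: "p \<in> P k" "v p = M k" using att by blast
      have "v (p @ [l]) \<le> M l" by (rule vM) (simp add: P_def)
      then show ?thesis using p v_snoc by simp
    qed
    show "M k = b k \<or> (\<exists>l. rank l < rank k \<and> M k = M l + w l k)" for k
    proof -
      have "\<exists>p\<in>P k. v p = M k \<and> length p = rank k"
        unfolding rank_def by (rule LeastI_ex) (use att in blast)
      then obtain p where p: "p \<in> P k" "v p = M k" "length p = rank k" by blast
      then obtain r where r: "p = r @ [k]" by (cases p rule: rev_cases) (auto simp: P_def)
      show ?thesis
      proof (cases "r = []")
        case True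
        then show ?thesis using p r by (simp add: v_def)
      next
        case False
        let ?l = "last r"
        have rP: "r \<in> P ?l" using False by (simp add: P_def)
        have 1: "M k = v r + w ?l k" using v_snoc[OF rP] p r by simp
        \<comment> \<open>Dropping the last vertex of an optimal walk leaves an optimal walk:
          \<open>step\<close> gives \<open>M ?l + w ?l k \<le> M k\<close>, and
          \<open>w ?l k\<close> cancels.\<close>
        have "v r = M ?l"
          using vM[OF rP] step[of ?l k] 1 by simp
        moreover from this have "rank ?l \<le> length r"
          unfolding rank_def by (intro Least_le) (use rP in blast)
        then have "rank ?l < rank k" using p r by simp
        ultimately show ?thesis using 1 by (intro disjI2 exI[of _ ?l]) simp
      qed
    qed
  qed
qed

section \<open>Greedy colouring along the ranks\<close>

text \<open>Columns are treated in order of rank. The parent row \<open>p k\<close> is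
  \<open>r\<close> or belongs to a column of smaller rank, so its colour is already fixed; the
  \<open>q - 1\<close> rows of column \<open>k\<close> then receive the other \<open>q - 1\<close>
  colours.\<close>

lemma tree_colouring:
  fixes \<mu> :: "'r \<Rightarrow> 'c" and rank :: "'c \<Rightarrow> nat"
  assumes "finite R" "q \<ge> 1" "r \<notin> R"
    and fibre: "\<And>k. card {i \<in> R. \<mu> i = k} = q - 1"
    and parent: "\<And>k. p k = r \<or> p k \<in> R \<and> rank (\<mu> (p k)) < rank k"
  shows "\<exists>col. (\<forall>k. rank k < n \<longrightarrow> {1..q} \<subseteq> col ` insert (p k) {i \<in> R. \<mu> i = k})
    \<and> range col \<subseteq> {1..q}"
proof (induction n)
  case 0
  show ?case using assms(2) by (intro exI[of _ "\<lambda>_. 1"]) auto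
next
  case (Suc n)
  then obtain col where col:
    "\<And>k. rank k < n \<Longrightarrow> {1..q} \<subseteq> col ` insert (p k) {i \<in> R. \<mu> i = k}" "\<And>i. col i \<in> {1..q}"
    by blast
  have "\<exists>f. bij_betw f {i \<in> R. \<mu> i = k} ({1..q} - {col (p k)})" for k
    using assms(1) fibre col(2) by (intro finite_same_card_bij) auto
  then obtain f where f: "\<And>k. bij_betw (f k) {i \<in> R. \<mu> i = k} ({1..q} - {col (p k)})"
    by metis
  \<comment> \<open>Only rows of columns of rank exactly \<open>n\<close> are recoloured; their
    parents and all columns of smaller rank keep their colours.\<close>
  define col' where "col' i = (if i \<in> R \<and> rank (\<mu> i) = n then f (\<mu> i) i else col i)" for i
  have old: "col' i = col i" if "i = r \<or> i \<in> R \<and> rank (\<mu> i) < n" for i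
    using that assms(3) by (auto simp: col'_def)
  have "{1..q} \<subseteq> col' ` insert (p k) {i \<in> R. \<mu> i = k}" if "rank k < Suc n" for k
  proof (cases "rank k = n")
    case True
    then have p: "col' (p k) = col (p k)" using parent[of k] old by auto
    have "col' ` {i \<in> R. \<mu> i = k} = f k ` {i \<in> R. \<mu> i = k}"
      using True by (intro image_cong) (auto simp: col'_def)
    also have "\<dots> = {1..q} - {col (p k)}" using f by (rule bij_betw_imp_surj_on)
    finally show ?thesis using p by auto
  next
    case False
    then have k: "rank k < n" using that by simp
    have "col' ` insert (p k) {i \<in> R. \<mu> i = k} = col ` insert (p k) {i \<in> R. \<mu> i = k}"
      using k parent[of k] by (intro image_cong refl old) auto
    then show ?thesis using col(1)[OF k] by simp
  qed
  moreover have "col' i \<in> {1..q}" for i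
    using bij_betw_apply[OF f, of i "\<mu> i"] col(2) unfolding col'_def by auto
  ultimately show ?case by blast
qed


section \<open>Optimal assignments and tight columns\<close>

lemma ex_fun_card_fibres:
  assumes "finite R" "card R = CARD('c::finite) * n"
  obtains \<mu> :: "'r \<Rightarrow> 'c::finite" where "\<And>k. card {i \<in> R. \<mu> i = k} = n"
proof -
  have "card R = card ((UNIV :: 'c set) \<times> {..<n})" using assms(2) by (simp add: card_cartesian_product)
  then obtain h where h: "bij_betw h R ((UNIV :: 'c set) \<times> {..<n})"
    using finite_same_card_bij[OF assms(1)] by (metis finite finite_cartesian_product finite_lessThan)
  show thesis
  proof
    fix k
    have "bij_betw h {i \<in> R. (fst \<circ> h) i = k} ({k} \<times> {..<n})"
    proof (rule bij_betw_subset[OF h])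
      have "h ` {i \<in> R. (fst \<circ> h) i = k} = {y \<in> h ` R. fst y = k}" by auto
      then show "h ` {i \<in> R. (fst \<circ> h) i = k} = {k} \<times> {..<n}"
        using bij_betw_imp_surj_on[OF h] by auto
    qed simp
    then show "card {i \<in> R. (fst \<circ> h) i = k} = n"
      by (simp add: bij_betw_same_card card_cartesian_product)
  qed
qed

lemma ex_tight_colouring:
  fixes a :: "'r \<Rightarrow> 'c::finite \<Rightarrow> 'g::linordered_ab_group_add"
  assumes "finite R" "q \<ge> 1" "card R = CARD('c) * (q - 1) + 1"
  obtains u M and col :: "'r \<Rightarrow> nat"
  where "\<And>i k. i \<in> R \<Longrightarrow> u i + a i k \<le> M k"
    "\<And>k c. c \<in> {1..q} \<Longrightarrow> \<exists>i\<in>R. col i = c \<and> u i + a i k = M k"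
\<comment> \<open>For \<open>q = 1\<close> no row is assigned to any column, and the maxima defining
  \<open>w\<close> would range over empty sets.\<close>
proof (cases "q = 1")
  case True
  then obtain r where "R = {r}" using assms(3) card_1_singletonE by auto
  then show thesis using True by (intro that[of "\<lambda>_. 0" "a r" "\<lambda>_. 1"]) auto
next
  case False
  then have q: "q - 1 > 0" using assms(2) by simp
  obtain r where r: "r \<in> R" using assms(3) by (metis card.empty add_is_0 one_neq_zero ex_in_conv)
  define S where "S = R - {r}"
  have S: "finite S" "r \<notin> S" "card S = CARD('c) * (q - 1)" "R = insert r S"
    using assms r by (auto simp: S_def)
  define A where "A = {\<mu> \<in> S \<rightarrow>\<^sub>E (UNIV :: 'c set). \<forall>k. card {i \<in> S. \<mu> i = k} = q - 1}"
  have "finite (S \<rightarrow>\<^sub>E (UNIV :: 'c set))" using S(1) by (rule finite_PiE) simp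
  then have "finite A" unfolding A_def by (rule finite_subset[rotated]) blast
  moreover have "A \<noteq> {}"
  proof -
    obtain \<mu> :: "'r \<Rightarrow> 'c" where "\<And>k. card {i \<in> S. \<mu> i = k} = q - 1"
      using ex_fun_card_fibres S by blast
    then have "restrict \<mu> S \<in> A" by (auto simp: A_def cong: conj_cong)
    then show ?thesis by blast
  qed
  ultimately have "Max ((\<lambda>\<nu>. \<Sum>i\<in>S. a i (\<nu> i)) ` A) \<in> (\<lambda>\<nu>. \<Sum>i\<in>S. a i (\<nu> i)) ` A" by simp
  then obtain \<mu> where \<mu>: "\<mu> \<in> A"
    and Max: "Max ((\<lambda>\<nu>. \<Sum>i\<in>S. a i (\<nu> i)) ` A) = (\<Sum>i\<in>S. a i (\<mu> i))"
    by (rule imageE)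
  have opt: "(\<Sum>i\<in>S. a i (\<nu> i)) \<le> (\<Sum>i\<in>S. a i (\<mu> i))" if "\<nu> \<in> A" for \<nu>
    using that \<open>finite A\<close> by (simp flip: Max)
  define F where "F k = {i \<in> S. \<mu> i = k}" for k
  have F: "finite (F k)" "card (F k) = q - 1" for k
    using \<mu> S by (auto simp: F_def A_def)
  have F_ne: "F k \<noteq> {}" for k using F(2)[of k] q by force
  define w where "w k l = Max ((\<lambda>j. a j l - a j k) ` F k)" for k l
  have w_le: "a j l - a j k \<le> w k l" if "j \<in> F k" for j k l
    using that F by (simp add: w_def)
  have w_att: "\<exists>j\<in>F k. w k l = a j l - a j k" for k l
  proof -
    have "w k l \<in> (\<lambda>j. a j l - a j k) ` F k" unfolding w_def using F(1) F_ne by (intro Max_in) auto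
    then show ?thesis by auto
  qed
  have perm: "(\<Sum>k\<in>UNIV. w k (\<pi> k)) \<le> 0" if \<pi>: "\<pi> permutes UNIV" for \<pi>
  proof -
    have "\<forall>k. \<exists>j. j \<in> F k \<and> w k (\<pi> k) = a j (\<pi> k) - a j k" using w_att by blast
    from choice[OF this] obtain j
      where j: "\<And>k. j k \<in> F k" "\<And>k. w k (\<pi> k) = a (j k) (\<pi> k) - a (j k) k"
      by blast
    \<comment> \<open>One row \<open>j k\<close> of largest gain moves from each column
      \<open>k\<close> to \<open>\<pi> k\<close>, all simultaneously. Every column loses one row and
      gains one, so the assignment stays balanced and optimality of \<open>\<mu>\<close>
      applies.\<close>
    define \<nu> where "\<nu> i = (if i \<in> S \<and> i = j (\<mu> i) then \<pi> (\<mu> i) else \<mu> i)" for i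
    have jS: "j k \<in> S" "\<mu> (j k) = k" for k using j(1)[of k] by (auto simp: F_def)
    have inj: "inj j" by (rule inj_on_inverseI[of _ \<mu>]) (rule jS)
    have \<pi>_inv: "\<pi> k = l \<longleftrightarrow> k = inv \<pi> l" for k l
      using permutes_inv_eq[OF \<pi>] by metis
    have "\<nu> \<in> A"
    proof -
      have "card {i \<in> S. \<nu> i = l} = q - 1" for l
      proof -
        have "{i \<in> S. \<nu> i = l} = insert (j (inv \<pi> l)) (F l - {j l})"
          using jS \<pi>_inv by (auto simp: \<nu>_def F_def)
        moreover have "j (inv \<pi> l) \<notin> F l - {j l}" using jS by (auto simp: F_def)
        ultimately show ?thesis using F j(1)[of l] q by simp
      qed
      then show ?thesis using \<mu> by (auto simp: A_def \<nu>_def PiE_iff extensional_def)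
    qed
    then have "(\<Sum>i\<in>S. a i (\<nu> i) - a i (\<mu> i)) \<le> 0" using opt by (simp add: sum_subtractf)
    also have "(\<Sum>i\<in>S. a i (\<nu> i) - a i (\<mu> i)) = (\<Sum>i\<in>range j. a i (\<nu> i) - a i (\<mu> i))"
      using S jS by (intro sum.mono_neutral_right) (auto simp: \<nu>_def)
    also have "\<dots> = (\<Sum>k\<in>UNIV. w k (\<pi> k))"
      using inj jS j(2) by (simp add: sum.reindex \<nu>_def)
    finally show ?thesis .
  qed
  have refl: "w k k = 0" for k using w_att[of k k] by auto
  obtain M and rank :: "'c \<Rightarrow> nat"
    where M: "\<And>k. a r k \<le> M k" "\<And>k l. M k + w k l \<le> M l"
      and par: "\<And>k. M k = a r k \<or> (\<exists>l. rank l < rank k \<and> M k = M l + w l k)"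
    using longest_walk_potential[of w "a r", OF perm refl] by blast
  \<comment> \<open>This weight makes every assigned row attain \<open>M\<close> in its own
    column.\<close>
  define u where "u i = (if i = r then 0 else M (\<mu> i) - a i (\<mu> i))" for i
  have tight: "u i + a i k = M k" if "i \<in> F k" for i k
    using that S by (auto simp: F_def u_def)
  \<comment> \<open>This is the \<open>q\<close>-th row attaining \<open>M k\<close>: either
    \<open>r\<close>, or the row of the preceding column that realizes the gain
    \<open>w l k\<close>.\<close>
  have "\<exists>p. (p = r \<or> p \<in> S \<and> rank (\<mu> p) < rank k) \<and> u p + a p k = M k" for k
    using par[of k]
  proof
    assume "M k = a r k"
    then show ?thesis by (intro exI[of _ r]) (simp add: u_def)
  next
    assume "\<exists>l. rank l < rank k \<and> M k = M l + w l k"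
    then obtain l where l: "rank l < rank k" "M k = M l + w l k" by blast
    obtain j where j: "j \<in> F l" "w l k = a j k - a j l" using w_att by blast
    have "u j + a j k = (u j + a j l) + w l k" using j(2) by (simp add: add.assoc)
    also have "\<dots> = M k" using l(2) tight[OF j(1)] by simp
    finally show ?thesis using j(1) l(1) by (intro exI[of _ j]) (simp add: F_def)
  qed
  then obtain p where p: "\<And>k. p k = r \<or> p k \<in> S \<and> rank (\<mu> (p k)) < rank k"
    "\<And>k. u (p k) + a (p k) k = M k" by metis
  have "\<exists>col. (\<forall>k. rank k < Suc (Max (range rank)) \<longrightarrow> {1..q} \<subseteq> col ` insert (p k) {i \<in> S. \<mu> i = k})
    \<and> range col \<subseteq> {1..q}"
    using S(1) assms(2) S(2) F(2)[unfolded F_def] p(1) by (rule tree_colouring)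
  moreover have "rank k < Suc (Max (range rank))" for k by (simp add: less_Suc_eq_le)
  ultimately obtain col where col: "\<And>k. {1..q} \<subseteq> col ` insert (p k) (F k)"
    unfolding F_def by blast
  show thesis
  proof
    show "u i + a i k \<le> M k" if "i \<in> R" for i k
    proof (cases "i = r")
      case True
      then show ?thesis using M by (simp add: u_def)
    next
      case False
      then have "i \<in> F (\<mu> i)" using that S by (simp add: F_def)
      then have "a i k - a i (\<mu> i) \<le> w (\<mu> i) k" by (rule w_le)
      then have "M (\<mu> i) + (a i k - a i (\<mu> i)) \<le> M k"
        using M(2)[of "\<mu> i" k] by (meson add_left_mono order_trans)
      then show ?thesis using False by (simp add: u_def algebra_simps)
    qed
    show "\<exists>i\<in>R. col i = c \<and> u i + a i k = M k" if c: "c \<in> {1..q}" for k c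
    proof -
      obtain i where i: "i \<in> insert (p k) (F k)" "col i = c" using col[of k] c by blast
      then have "i \<in> R" using p(1)[of k] S(4) by (auto simp: F_def)
      then show ?thesis using i p(2) tight by auto
    qed
  qed
qed

section \<open>Polynomials in place of max-plus numbers\<close>

definition poly_of_ereal :: "ereal \<Rightarrow> real poly" where
  "poly_of_ereal x = (if x = -\<infinity> then [:0, -1:] else [:real_of_ereal x:])"

text \<open>
  A non-constant polynomial goes to \<open>-\<infinity>\<close> even if it is positively infinite; only polynomials
  bounded above by a constant are of interest.
\<close>

definition ereal_of_poly :: "real poly \<Rightarrow> ereal" where
  "ereal_of_poly p = (if degree p = 0 then ereal (coeff p 0) else -\<infinity>)"

lemma const_poly_le_iff [simp]: "[:c:] \<le> [:d:] \<longleftrightarrow> c \<le> (d::real)"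
  by (auto simp: less_eq_poly_def pos_poly_pCons)

text \<open>Adding a constant does not change the leading coefficient of a non-constant polynomial,
  so such a polynomial lies above all constants or below all of them.\<close>

lemma degree_eq_0_if_between:
  assumes "[:c:] \<le> p" "p \<le> [:d:]"
  shows "degree (p :: real poly) = 0"
proof (rule ccontr)
  assume deg: "degree p \<noteq> 0"
  have lead: "lead_coeff (p + [:e:]) = lead_coeff p" for e
  proof -
    have "degree (p + [:e:]) = degree p" using deg by (intro degree_add_eq_left) simp
    then show ?thesis using deg by (simp add: coeff_pCons split: nat.splits)
  qed
  have "lead_coeff (p - [:c:]) = lead_coeff p"
    using lead[of "- c"] by (simp only: diff_conv_add_uminus minus_pCons minus_zero)
  moreover have "lead_coeff ([:d:] - p) = - lead_coeff p"
  proof -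
    have "[:d:] - p = - (p + [:- d:])" by simp
    then show ?thesis using lead[of "- d"] by (simp only: degree_minus coeff_minus)
  qed
  moreover have "lead_coeff q \<ge> 0" if "q \<ge> 0" for q :: "real poly"
    using that by (auto simp: less_eq_poly_def pos_poly_def)
  ultimately have "lead_coeff p = 0" using assms by (metis diff_ge_0_iff_ge neg_0_le_iff_le order_antisym)
  then show False using deg by auto
qed

text \<open>The bound \<open>[:c:]\<close> excludes a constant \<open>p\<close> below a positively
  infinite \<open>r\<close>, which would be sent to \<open>-\<infinity>\<close>.\<close>

lemma ereal_of_poly_mono:
  assumes "p \<le> r" "r \<le> [:c:]"
  shows "ereal_of_poly p \<le> ereal_of_poly r"
proof (cases "degree p = 0")
  case True
  then obtain d where d: "p = [:d:]" by (rule degree_eq_zeroE)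
  then obtain e where "r = [:e:]" using degree_eq_0_if_between assms by (metis degree_eq_zeroE)
  then show ?thesis using d assms by (simp add: ereal_of_poly_def)
qed (simp add: ereal_of_poly_def)

text \<open>The sign condition prevents cancellation when \<open>x = -\<infinity>\<close>: the sum
  could be constant only if \<open>p\<close> were \<open>X\<close> plus a constant, which is
  positive.\<close>

lemma ereal_of_poly_add:
  assumes "p \<le> 0" "x \<noteq> \<infinity>"
  shows "ereal_of_poly (p + poly_of_ereal x) = ereal_of_poly p + x"
proof (cases x)
  case (real y)
  have "degree (p + [:y:]) = degree p"
    by (cases "degree p = 0") (auto simp: degree_add_eq_left elim!: degree_eq_zeroE)
  then show ?thesis using real by (simp add: ereal_of_poly_def poly_of_ereal_def)
next
  case MInf
  have "degree (p + [:0, -1:]) \<noteq> 0"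
  proof
    assume "degree (p + [:0, -1:]) = 0"
    then obtain c where "p + [:0, -1:] = [:c:]" by (rule degree_eq_zeroE)
    then have "p = [:c:] - [:0, -1:]" by (metis add_diff_cancel_right')
    then show False using assms(1) by (simp add: less_eq_poly_def pos_poly_pCons)
  qed
  then show ?thesis using MInf by (simp add: ereal_of_poly_def poly_of_ereal_def)
qed (use assms in simp)

theorem theorem11:
  fixes X :: "(ereal ^ 'd) set" and q :: nat
  assumes "q \<ge> 1"
    and "X \<subseteq> Rmax_vecs"
    and "finite X"
    and "card X = (CARD('d) + 1) * (q - 1) + 1"
  shows "\<exists>Y :: nat \<Rightarrow> (ereal ^ 'd) set.
           (\<forall>i\<in>{1..q}. Y i \<subseteq> X) \<and>
           disjoint_family_on Y {1..q} \<and>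
           (\<exists>x. \<forall>i\<in>{1..q}. x \<in> maxplus_hull (Y i))"
proof -
  define a :: "ereal ^ 'd \<Rightarrow> 'd option \<Rightarrow> real poly"
    where "a p k = (case k of None \<Rightarrow> 0 | Some i \<Rightarrow> poly_of_ereal (p $ i))" for p k
  have "card X = CARD('d option) * (q - 1) + 1" using assms(4) by (simp add: card_option)
  then obtain u M and col :: "ereal ^ 'd \<Rightarrow> nat"
    where le: "\<And>p k. p \<in> X \<Longrightarrow> u p + a p k \<le> M k"
      and tight: "\<And>k c. c \<in> {1..q} \<Longrightarrow> \<exists>p\<in>X. col p = c \<and> u p + a p k = M k"
    using ex_tight_colouring[OF assms(3,1), of a] by metis
  \<comment> \<open>Column \<open>None\<close> is the added coordinate \<open>0\<close>. Subtracting
    \<open>M None\<close> turns its tightness into the normalization of the hull coefficients: their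
    maximum is \<open>0\<close> in every colour.\<close>
  define v where "v p = u p - M None" for p
  define N where "N i = M (Some i) - M None" for i
  define Y where "Y c = {p \<in> X. col p = c}" for c
  define x :: "ereal ^ 'd" where "x = (\<chi> i. ereal_of_poly (N i))"
  have v: "v p \<le> 0" if "p \<in> X" for p using le[OF that, of None] by (simp add: v_def a_def)
  have v_le: "v p + poly_of_ereal (p $ i) \<le> N i" if "p \<in> X" for p i
    using le[OF that, of "Some i"] by (simp add: v_def N_def a_def algebra_simps)
  have fin: "p $ i \<noteq> \<infinity>" if "p \<in> X" for p i
    using that assms(2) by (auto simp: Rmax_vecs_def Rmax_def)
  have hull: "x \<in> maxplus_hull (Y c)" if c: "c \<in> {1..q}" for c
  proof -
    obtain p0 where p0: "p0 \<in> Y c" "v p0 = 0"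
      using tight[OF c, of None] by (auto simp: Y_def v_def a_def)
    have att: "\<exists>p\<in>Y c. v p + poly_of_ereal (p $ i) = N i" for i
      using tight[OF c, of "Some i"] by (force simp: Y_def v_def N_def a_def)
    have finY: "finite (Y c)" using assms(3) by (simp add: Y_def)
    have "Max ((\<lambda>p. ereal_of_poly (v p)) ` Y c) = 0"
    proof (rule Max_eqI)
      show "y \<le> 0" if "y \<in> (\<lambda>p. ereal_of_poly (v p)) ` Y c" for y
        using that ereal_of_poly_mono[of _ 0 0] v by (fastforce simp: Y_def ereal_of_poly_def)
      show "0 \<in> (\<lambda>p. ereal_of_poly (v p)) ` Y c"
        using p0 by (force simp: ereal_of_poly_def)
    qed (use finY in simp)
    moreover have "x = max_vec ((\<lambda>p. shift (ereal_of_poly (v p)) p) ` Y c)"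
    proof -
      have "Max ((\<lambda>p. ereal_of_poly (v p) + p $ i) ` Y c) = ereal_of_poly (N i)" for i
      proof -
        obtain p where p: "p \<in> Y c" "v p + poly_of_ereal (p $ i) = N i" using att by blast
        have eq: "ereal_of_poly (v p') + p' $ i = ereal_of_poly (v p' + poly_of_ereal (p' $ i))"
          if "p' \<in> Y c" for p'
          using that v fin by (simp add: Y_def ereal_of_poly_add)
        \<comment> \<open>Since \<open>v p \<le> 0\<close>, a constant above the entry of
          \<open>p\<close> also bounds \<open>N i\<close>, as monotonicity of
          \<open>ereal_of_poly\<close> requires.\<close>
        obtain b where b: "poly_of_ereal (p $ i) \<le> [:b:]"
        proof (cases "p $ i = -\<infinity>")
          case True
          then show thesis by (intro that[of 0]) (simp add: poly_of_ereal_def less_eq_poly_def pos_poly_pCons)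
        qed (auto simp: poly_of_ereal_def)
        have N_le: "N i \<le> [:b:]"
          using p b v[of p] add_mono[of "v p" 0 "poly_of_ereal (p $ i)" "[:b:]"] by (simp add: Y_def)
        show ?thesis
        proof (rule Max_eqI)
          show "y \<le> ereal_of_poly (N i)" if "y \<in> (\<lambda>p. ereal_of_poly (v p) + p $ i) ` Y c" for y
            using that eq v_le N_le by (auto simp: Y_def intro!: ereal_of_poly_mono)
          show "ereal_of_poly (N i) \<in> (\<lambda>p. ereal_of_poly (v p) + p $ i) ` Y c"
            using p eq by (metis (no_types, lifting) imageI)
        qed (use finY in simp)
      qed
      then show ?thesis by (simp add: x_def max_vec_def shift_def image_image)
    qed
    moreover have "ereal_of_poly r \<in> Rmax" for r by (simp add: ereal_of_poly_def Rmax_def)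
    moreover from this have "x \<in> Rmax_vecs" by (simp add: x_def Rmax_vecs_def)
    moreover have "Y c \<noteq> {}" using p0 by blast
    ultimately show ?thesis
      unfolding maxplus_hull_def by (intro CollectI conjI exI[of _ "\<lambda>p. ereal_of_poly (v p)"] ballI)
  qed
  have "\<forall>i\<in>{1..q}. Y i \<subseteq> X" "disjoint_family_on Y {1..q}"
    by (auto simp: Y_def disjoint_family_on_def)
  then show ?thesis using hull by blast
qed

end
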